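(* Let $N$ be a manifold of dimension $n$. Let $f$ be an immersion of $N$ into an open subset $U$ of $\mathbb{R}^m$. Let $F:U\to\mathbb{R}$ be a mapping. Then there exists a subset $\Sigma$ of $\mathcal{L}(\mathbb{R}^m,\mathbb{R})$ with Lebesgue measure zero such that for any $\pi\in\mathcal{L}(\mathbb{R}^m,\mathbb{R})-\Sigma$, the mapping $F_\pi\circ f:N\to\mathbb{R}$ is a Morse function.
   Context: Conventions: $m,n$ are positive integers; all manifolds and mappings are of class $C^\infty$ and all manifolds are without boundary. $\mathcal{L}(\mathbb{R}^m,\mathbb{R})$ is the space of all linear mappings $\mathbb{R}^m\to\mathbb{R}$, identified with $\mathbb{R}^m$, which gives it Lebesgue measure. For $\pi\in\mathcal{L}(\mathbb{R}^m,\mathbb{R})$ and $F:U\to\mathbb{R}$, $F_\pi=F+\pi|_U:U\to\mathbb{R}$. A mapping $g:N\to\mathbb{R}$ is called a Morse function if all of its singularities (critical points) are nondegenerate. *)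

theory Defs
  imports "HOL-Analysis.Analysis"
begin

text \<open>Intended for open \<open>S\<close>. In finite dimension, continuity of \<open>x \<mapsto> Df(x) v\<close> for
  every fixed \<open>v\<close> is the same as continuity of \<open>Df\<close>, so this is the usual notion of a
  \<open>C\<^sup>k\<close> map; directional derivatives keep the type of the map fixed in the recursion.\<close>

primrec Ck_on ::
  "nat \<Rightarrow> 'a::euclidean_space set \<Rightarrow> ('a \<Rightarrow> 'b::euclidean_space) \<Rightarrow> bool"
where
  "Ck_on 0 S f \<longleftrightarrow> continuous_on S f"
| "Ck_on (Suc k) S f \<longleftrightarrow>
     (\<forall>x\<in>S. f differentiable (at x)) \<and>
     (\<forall>v. Ck_on k S (\<lambda>x. frechet_derivative f (at x) v))"

definition smooth_on ::
  "'a::euclidean_space set \<Rightarrow> ('a \<Rightarrow> 'b::euclidean_space) \<Rightarrow> bool"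
  where "smooth_on S f \<longleftrightarrow> (\<forall>k. Ck_on k S f)"

text \<open>A chart is a pair of its domain and its coordinate map; the values of the coordinate
  map outside the domain are irrelevant.\<close>

type_synonym ('a, 'n) chart = "'a set \<times> ('a \<Rightarrow> real ^ 'n)"

definition chart_inv :: "('a, 'n) chart \<Rightarrow> real ^ 'n \<Rightarrow> 'a"
  where "chart_inv c = inv_into (fst c) (snd c)"

definition is_chart :: "'a topology \<Rightarrow> ('a, 'n::finite) chart \<Rightarrow> bool"
  where "is_chart X c \<longleftrightarrow>
    openin X (fst c) \<and> open (snd c ` fst c) \<and>
    homeomorphic_map (subtopology X (fst c)) (top_of_set (snd c ` fst c)) (snd c)"

text \<open>A manifold of dimension \<open>CARD('n)\<close> without boundary. The atlas need not be maximal: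
  the notions below do not change when further compatible charts are added.\<close>

definition smooth_manifold :: "'a topology \<Rightarrow> ('a, 'n::finite) chart set \<Rightarrow> bool"
  where "smooth_manifold X A \<longleftrightarrow>
    Hausdorff_space X \<and> second_countable X \<and>
    (\<forall>c\<in>A. is_chart X c) \<and> (\<Union>c\<in>A. fst c) = topspace X \<and>
    (\<forall>c\<in>A. \<forall>d\<in>A. smooth_on (snd c ` (fst c \<inter> fst d)) (snd d \<circ> chart_inv c))"

definition smooth_map ::
  "('a, 'n::finite) chart set \<Rightarrow> ('a \<Rightarrow> 'b::euclidean_space) \<Rightarrow> bool"
  where "smooth_map A g \<longleftrightarrow> (\<forall>c\<in>A. smooth_on (snd c ` fst c) (g \<circ> chart_inv c))"

definition chart_differential ::
  "('a, 'n::finite) chart \<Rightarrow> ('a \<Rightarrow> 'b::euclidean_space) \<Rightarrow> 'a \<Rightarrow> real ^ 'n \<Rightarrow> 'b"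
  where "chart_differential c g p = frechet_derivative (g \<circ> chart_inv c) (at (snd c p))"

definition immersion_into ::
  "'a topology \<Rightarrow> ('a, 'n::finite) chart set \<Rightarrow> 'b::euclidean_space set \<Rightarrow> ('a \<Rightarrow> 'b) \<Rightarrow> bool"
  where "immersion_into X A U f \<longleftrightarrow>
    f ` topspace X \<subseteq> U \<and> smooth_map A f \<and>
    (\<forall>c\<in>A. \<forall>p\<in>fst c. inj (chart_differential c f p))"

definition hessian :: "(real ^ 'n::finite \<Rightarrow> real) \<Rightarrow> real ^ 'n \<Rightarrow> real ^ 'n ^ 'n"
  where "hessian h x =
    (\<chi> i j. frechet_derivative (\<lambda>y. frechet_derivative h (at y) (axis j 1)) (at x) (axis i 1))"

text \<open>For smooth functions both notions are independent of the chart around \<open>p\<close>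
  (for the second one, at critical points).\<close>

definition critical_point :: "('a, 'n::finite) chart set \<Rightarrow> ('a \<Rightarrow> real) \<Rightarrow> 'a \<Rightarrow> bool"
  where "critical_point A g p \<longleftrightarrow>
    (\<exists>c\<in>A. p \<in> fst c \<and> chart_differential c g p = (\<lambda>v. 0))"

definition nondegenerate_at :: "('a, 'n::finite) chart set \<Rightarrow> ('a \<Rightarrow> real) \<Rightarrow> 'a \<Rightarrow> bool"
  where "nondegenerate_at A g p \<longleftrightarrow>
    (\<forall>c\<in>A. p \<in> fst c \<longrightarrow> det (hessian (g \<circ> chart_inv c) (snd c p)) \<noteq> 0)"

definition Morse_function ::
  "'a topology \<Rightarrow> ('a, 'n::finite) chart set \<Rightarrow> ('a \<Rightarrow> real) \<Rightarrow> bool"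
  where "Morse_function X A g \<longleftrightarrow>
    smooth_map A g \<and>
    (\<forall>p\<in>topspace X. critical_point A g p \<longrightarrow> nondegenerate_at A g p)"

definition linear_forms :: "(real ^ 'm::finite \<Rightarrow> real) set"
  where "linear_forms = {\<pi>. linear \<pi>}"

text \<open>The identification of the space of linear forms with \<open>\<real>\<^sup>m\<close>.\<close>

definition form_coords :: "(real ^ 'm::finite \<Rightarrow> real) \<Rightarrow> real ^ 'm"
  where "form_coords \<pi> = (\<chi> i. \<pi> (axis i 1))"

definition null_forms :: "(real ^ 'm::finite \<Rightarrow> real) set \<Rightarrow> bool"
  where "null_forms \<Sigma> \<longleftrightarrow> \<Sigma> \<subseteq> linear_forms \<and> form_coords ` \<Sigma> \<in> null_sets lebesgue"

definition perturb ::
  "(real ^ 'm::finite \<Rightarrow> real) \<Rightarrow> (real ^ 'm \<Rightarrow> real) \<Rightarrow> real ^ 'm \<Rightarrow> real"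
  where "perturb F \<pi> = (\<lambda>x. F x + \<pi> x)"

end

theory Submission
  imports Defs
begin

text \<open>
  In a chart, write \<open>\<phi>\<close> for the coordinate expression of the immersion and put
  \<open>h = F \<circ> \<phi>\<close>. For the linear form with coefficient vector \<open>a\<close> the perturbed function is
  \<open>g a = h + a \<bullet> \<phi>\<close>, and \<open>x\<close> is a critical point of it iff \<open>\<nabla>h(x) + J(x)\<^sup>T a = 0\<close>, where \<open>J\<close>
  is the Jacobian matrix of \<open>\<phi>\<close>. Because \<open>J(x)\<close> is injective, the pairs \<open>(x, a)\<close> that satisfy
  this equation form a manifold of the same dimension \<open>m\<close> as the space of forms, and the
  projection \<open>(x, a) \<mapsto> a\<close> fails to be a local diffeomorphism exactly where the Hessian of
  \<open>g a\<close> at \<open>x\<close> is degenerate. Hence the forms with a degenerate critical point are critical values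
  of a map between spaces of dimension \<open>m\<close>, and the equidimensional case of Sard's theorem
  makes them a null set. This is the parametric transversality argument, with the
  surjectivity of the transposed Jacobian in the role of transversality.

  The proof near \<open>x0\<close> (lemma \<open>degenerate_parameters_locally_negligible\<close>) replaces the manifold of
  critical pairs by an explicit parametrization \<open>z \<mapsto> (\<xi> z, \<Psi> z)\<close> over an open subset of
  \<open>\<real>\<^sup>m\<close>. With \<open>M = J(x0)\<close>, every \<open>a\<close> splits as \<open>k + M c\<close> with \<open>M\<^sup>T k = 0\<close>. For \<open>x\<close> near
  \<open>x0\<close> the matrix \<open>J(x)\<^sup>T M\<close> is invertible, so the critical equation determines \<open>c\<close> from \<open>x\<close> and
  \<open>k\<close>; and \<open>z \<in> \<real>\<^sup>m\<close> encodes the pair of \<open>x - x0 = M\<^sup>T z\<close> and of the projection of \<open>z\<close> to the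
  kernel of \<open>M\<^sup>T\<close>, which is taken for \<open>k\<close>. Differentiating the critical equation
  \<open>\<nabla>(g (\<Psi> z))(\<xi> z) = 0\<close> in a direction that moves \<open>x\<close> along the kernel of the Hessian and leaves
  \<open>k\<close> fixed shows that this direction lies in the kernel of the derivative of \<open>\<Psi>\<close>.

  On the manifold, the Hessian at a critical point changes by congruence from chart to
  chart (lemma \<open>critical_nondegenerate_change_of_chart\<close>), so one chart around each point decides about
  all of them. Second countability then covers the manifold by countably many of the
  neighbourhoods on which the bad forms are null.
\<close>

section \<open>Sard's theorem between spaces of equal dimension\<close>

text \<open>The theorem \<open>baby_Sard\<close> asks for a well-ordered index type, whereas the dimension of the
  space of forms is given by an arbitrary finite type. A copy of that type carries a well-order
  obtained from an enumeration.\<close>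

typedef 'a wellordered = "UNIV :: 'a set" by simp

instance wellordered :: (finite) finite
proof
  have "(UNIV :: 'a wellordered set) = range Abs_wellordered"
    by (metis Rep_wellordered_inverse UNIV_eq_I rangeI)
  then show "finite (UNIV :: 'a wellordered set)"
    by (metis finite finite_imageI)
qed

lemma bij_Rep_wellordered: "bij Rep_wellordered"
  by (metis Abs_wellordered_inverse Rep_wellordered_inverse UNIV_I bijI')

lemma CARD_wellordered: "CARD('a wellordered) = CARD('a)"
  using bij_betw_same_card[OF bij_Rep_wellordered] .

instantiation wellordered :: (countable) wellorder
begin

definition less_eq_wellordered :: "'a wellordered \<Rightarrow> 'a wellordered \<Rightarrow> bool"
  where "x \<le> y \<longleftrightarrow> to_nat (Rep_wellordered x) \<le> to_nat (Rep_wellordered y)"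

definition less_wellordered :: "'a wellordered \<Rightarrow> 'a wellordered \<Rightarrow> bool"
  where "x < y \<longleftrightarrow> to_nat (Rep_wellordered x) < to_nat (Rep_wellordered y)"

instance
proof
  fix P :: "'a wellordered \<Rightarrow> bool" and a
  assume step: "\<And>x. (\<And>y. y < x \<Longrightarrow> P y) \<Longrightarrow> P x"
  show "P a"
    by (induction a rule: measure_induct_rule[where f = "\<lambda>x. to_nat (Rep_wellordered x)"])
      (rule step, simp add: less_wellordered_def)
qed (auto simp: less_eq_wellordered_def less_wellordered_def Rep_wellordered_inject)

end

lemma Sard_equidimensional_wellordered:
  fixes f :: "real ^ 'm::{finite,wellorder} \<Rightarrow> real ^ 'm::_"
  assumes "\<And>x. x \<in> S \<Longrightarrow> (f has_derivative f' x) (at x within S)"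
    and "\<And>x. x \<in> S \<Longrightarrow> \<not> inj (f' x)"
  shows "negligible (f ` S)"
proof (rule baby_Sard)
  fix x assume x: "x \<in> S"
  have "linear (f' x)"
    using assms(1)[OF x] by (rule has_derivative_linear)
  then have "det (matrix (f' x)) = 0"
    using det_nz_iff_inj assms(2)[OF x] by blast
  then show "rank (matrix (f' x)) < CARD('m)"
    by (simp add: det_eq_0_rank)
qed (use assms in auto)

text \<open>Relabelling the coordinates by the well-ordered copy of the index type is a linear
  isomorphism, and linear maps between spaces of equal dimension carry null sets to null sets.\<close>

lemma Sard_equidimensional:
  fixes f :: "real ^ 'm::finite \<Rightarrow> real ^ 'm"
  assumes der: "\<And>x. x \<in> S \<Longrightarrow> (f has_derivative f' x) (at x within S)"
    and sing: "\<And>x. x \<in> S \<Longrightarrow> \<not> inj (f' x)"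
  shows "negligible (f ` S)"
proof -
  define P :: "real ^ 'm \<Rightarrow> real ^ ('m wellordered)"
    where "P x = (\<chi> i. x $ Rep_wellordered i)" for x
  define Q :: "real ^ ('m wellordered) \<Rightarrow> real ^ 'm"
    where "Q y = (\<chi> i. y $ Abs_wellordered i)" for y
  have QP: "Q (P x) = x" for x
    by (simp add: P_def Q_def vec_eq_iff Abs_wellordered_inverse)
  have PQ: "P (Q x) = x" for x
    by (simp add: P_def Q_def vec_eq_iff Rep_wellordered_inverse)
  have lP: "linear P" and lQ: "linear Q"
    by (auto simp: P_def Q_def linear_iff vec_eq_iff)
  then have P: "bounded_linear P" and Q: "bounded_linear Q"
    by (simp_all add: linear_conv_bounded_linear)
  have "negligible ((P \<circ> f \<circ> Q) ` (P ` S))"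
  proof (rule Sard_equidimensional_wellordered)
    fix y assume "y \<in> P ` S"
    then obtain x where x: "x \<in> S" "y = P x" by blast
    have im: "Q ` (P ` S) = S" by (auto simp: QP image_iff)
    have "(f has_derivative f' x) (at (Q y) within Q ` (P ` S))"
      using der[OF x(1)] by (simp add: x QP im)
    moreover have "(Q has_derivative Q) (at y within P ` S)"
      by (rule bounded_linear_imp_has_derivative[OF Q])
    ultimately have "((\<lambda>z. f (Q z)) has_derivative (\<lambda>v. f' x (Q v))) (at y within P ` S)"
      by (rule has_derivative_in_compose[rotated])
    then have "((\<lambda>z. P (f (Q z))) has_derivative (\<lambda>v. P (f' x (Q v)))) (at y within P ` S)"
      by (rule bounded_linear.has_derivative[OF P])
    then show "(P \<circ> f \<circ> Q has_derivative (P \<circ> f' (Q y) \<circ> Q)) (at y within P ` S)"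
      by (simp add: o_def x QP)
    obtain u v where "u \<noteq> v" "f' x u = f' x v"
      using sing[OF x(1)] by (auto simp: inj_def)
    then have "P u \<noteq> P v" "(P \<circ> f' (Q y) \<circ> Q) (P u) = (P \<circ> f' (Q y) \<circ> Q) (P v)"
      by (auto simp: x QP) (metis QP)
    then show "\<not> inj (P \<circ> f' (Q y) \<circ> Q)"
      by (meson injD)
  qed
  then have "negligible (Q ` ((P \<circ> f \<circ> Q) ` (P ` S)))"
    by (rule negligible_differentiable_image_negligible[rotated])
      (simp_all add: CARD_wellordered linear_imp_differentiable_on lQ)
  moreover have "Q ` ((P \<circ> f \<circ> Q) ` (P ` S)) = f ` S"
    by (simp add: image_image QP)
  ultimately show ?thesis by simp
qed

section \<open>Maps of class \<open>C\<^sup>k\<close>\<close>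

text \<open>Openness of \<open>S\<close> makes derivatives at points of \<open>S\<close> depend only on the values in \<open>S\<close>. This is
  what allows any formula for the derivative that is valid on \<open>S\<close> to be used in place of
  \<open>frechet_derivative\<close>.\<close>

lemma Ck_on_cong:
  assumes "open S" "\<And>x. x \<in> S \<Longrightarrow> f x = g x" "Ck_on k S f"
  shows "Ck_on k S g"
  using assms(2,3)
proof (induction k arbitrary: f g)
  case 0
  then show ?case by (auto intro: continuous_on_eq)
next
  case (Suc k)
  have diff: "f differentiable (at x)" if "x \<in> S" for x
    using Suc.prems(2) that by simp
  have "(g has_derivative frechet_derivative f (at x)) (at x)" if "x \<in> S" for x
    using diff[OF that, unfolded frechet_derivative_works] Suc.prems(1)
    by (rule has_derivative_transform_within_open[OF _ assms(1) that])
  then have "g differentiable (at x)" if "x \<in> S" for x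
    using that differentiableI by blast
  moreover have "Ck_on k S (\<lambda>x. frechet_derivative g (at x) v)" for v
  proof (rule Suc.IH)
    show "frechet_derivative f (at x) v = frechet_derivative g (at x) v" if "x \<in> S" for x
      using frechet_derivative_transform_within_open[OF diff[OF that] assms(1) that Suc.prems(1)]
      by simp
    show "Ck_on k S (\<lambda>x. frechet_derivative f (at x) v)"
      using Suc.prems(2) by simp
  qed
  ultimately show ?case by simp
qed

lemma Ck_on_SucI:
  assumes "open S"
    and der: "\<And>x. x \<in> S \<Longrightarrow> (f has_derivative f' x) (at x)"
    and "\<And>v. Ck_on k S (\<lambda>x. f' x v)"
  shows "Ck_on (Suc k) S f"
proof -
  have "f' x v = frechet_derivative f (at x) v" if "x \<in> S" for x v
    using frechet_derivative_at[OF der[OF that]] by simp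
  then show ?thesis
    using assms by (auto simp: differentiable_def intro: Ck_on_cong[OF assms(1) _ assms(3)])
qed

lemma Ck_on_SucD:
  assumes "Ck_on (Suc k) S f"
  shows "x \<in> S \<Longrightarrow> (f has_derivative frechet_derivative f (at x)) (at x)"
    and "Ck_on k S (\<lambda>x. frechet_derivative f (at x) v)"
  using assms frechet_derivative_works by auto

lemma Ck_on_Suc_imp:
  assumes "Ck_on (Suc k) S f"
  shows "Ck_on k S f"
  using assms
proof (induction k arbitrary: f)
  case 0
  then show ?case
    by (auto intro!: continuous_at_imp_continuous_on differentiable_imp_continuous_within)
next
  case (Suc k)
  then show ?case by (meson Ck_on.simps(2))
qed

lemma Ck_on_const: "Ck_on k S (\<lambda>x. c)"
  by (induction k arbitrary: c) (simp_all add: frechet_derivative_const)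

lemma Ck_on_bounded_linear:
  assumes "open S" "bounded_linear L" "Ck_on k S f"
  shows "Ck_on k S (\<lambda>x. L (f x))"
  using assms(3)
proof (induction k arbitrary: f)
  case 0
  then show ?case
    using bounded_linear.continuous_on[OF assms(2)] by auto
next
  case (Suc k)
  show ?case
    by (rule Ck_on_SucI[OF assms(1) bounded_linear.has_derivative[OF assms(2)]])
      (use Ck_on_SucD[OF Suc.prems] Suc.IH in auto)
qed

lemma Ck_on_add:
  assumes "open S" "Ck_on k S f" "Ck_on k S g"
  shows "Ck_on k S (\<lambda>x. f x + g x)"
  using assms(2,3)
proof (induction k arbitrary: f g)
  case 0
  then show ?case by (auto intro: continuous_on_add)
next
  case (Suc k)
  show ?case
    by (rule Ck_on_SucI[OF assms(1) has_derivative_add])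
      (use Ck_on_SucD[OF Suc.prems(1)] Ck_on_SucD[OF Suc.prems(2)] Suc.IH in auto)
qed

lemma Ck_on_sum:
  assumes "open S" "\<And>i. i \<in> I \<Longrightarrow> Ck_on k S (f i)"
  shows "Ck_on k S (\<lambda>x. \<Sum>i\<in>I. f i x)"
  using assms(2)
  by (induction I rule: infinite_finite_induct) (simp_all add: Ck_on_const Ck_on_add assms(1))

lemma Ck_on_scaleR:
  fixes u :: "'a::euclidean_space \<Rightarrow> real"
  assumes "open S" "Ck_on k S u" "Ck_on k S g"
  shows "Ck_on k S (\<lambda>x. u x *\<^sub>R g x)"
  using assms(2,3)
proof (induction k arbitrary: u g)
  case 0
  then show ?case by (auto intro: continuous_on_scaleR)
next
  case (Suc k)
  let ?D = "\<lambda>f x. frechet_derivative f (at x)"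
  have "((\<lambda>x. u x *\<^sub>R g x) has_derivative (\<lambda>v. u x *\<^sub>R ?D g x v + ?D u x v *\<^sub>R g x)) (at x)"
    if "x \<in> S" for x
    using that Suc.prems by (intro has_derivative_scaleR Ck_on_SucD(1)[where S = S and k = k])
  moreover have "Ck_on k S (\<lambda>x. u x *\<^sub>R ?D g x v + ?D u x v *\<^sub>R g x)" for v
    by (intro Ck_on_add[OF assms(1)] Suc.IH Ck_on_SucD(2) Suc.prems
        Ck_on_Suc_imp[OF Suc.prems(1)] Ck_on_Suc_imp[OF Suc.prems(2)])
  ultimately show ?case
    by (rule Ck_on_SucI[OF assms(1)])
qed

text \<open>The directional derivative of the composition is \<open>DF(\<phi> x)(D\<phi>(x) v)\<close>, whose direction depends on
  \<open>x\<close>. Expanding that direction in a basis turns it into a sum of products of class \<open>C\<^sup>k\<close>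
  functions, where the factors \<open>DF(\<phi> x) b\<close> have a fixed direction \<open>b\<close> and fall under the induction
  hypothesis.\<close>

lemma Ck_on_compose:
  assumes "open S" "\<phi> ` S \<subseteq> T" "Ck_on k S \<phi>" "Ck_on k T F"
  shows "Ck_on k S (\<lambda>x. F (\<phi> x))"
  using assms(3,4)
proof (induction k arbitrary: F)
  case 0
  then show ?case
    using assms(2) by (auto intro: continuous_on_compose2)
next
  case (Suc k)
  let ?D = "\<lambda>F x. frechet_derivative F (at x)"
  have F: "(F has_derivative ?D F (\<phi> x)) (at (\<phi> x))" if "x \<in> S" for x
    using Ck_on_SucD(1)[OF Suc.prems(2)] assms(2) that by blast
  have der: "((\<lambda>x. F (\<phi> x)) has_derivative (\<lambda>v. ?D F (\<phi> x) (?D \<phi> x v))) (at x)" if "x \<in> S" for x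
    by (rule has_derivative_compose[OF Ck_on_SucD(1)[OF Suc.prems(1) that] F[OF that]])
  have expand: "(\<Sum>b\<in>Basis. (?D \<phi> x v \<bullet> b) *\<^sub>R ?D F (\<phi> x) b) = ?D F (\<phi> x) (?D \<phi> x v)"
    if "x \<in> S" for x v
  proof -
    have "?D F (\<phi> x) (\<Sum>b\<in>Basis. (?D \<phi> x v \<bullet> b) *\<^sub>R b) =
        (\<Sum>b\<in>Basis. (?D \<phi> x v \<bullet> b) *\<^sub>R ?D F (\<phi> x) b)"
      using has_derivative_linear[OF F[OF that]] by (simp only: linear_sum linear_cmul)
    then show ?thesis by (simp only: euclidean_representation)
  qed
  have "Ck_on k S (\<lambda>x. ?D F (\<phi> x) b)" for b
    using Suc.IH[OF Ck_on_Suc_imp Ck_on_SucD(2)] Suc.prems by simp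
  then have "Ck_on k S (\<lambda>x. (?D \<phi> x v \<bullet> b) *\<^sub>R ?D F (\<phi> x) b)" for v b
    by (intro Ck_on_scaleR[OF assms(1)]
        Ck_on_bounded_linear[OF assms(1) bounded_linear_inner_left] Ck_on_SucD(2)[OF Suc.prems(1)])
  then have sum: "Ck_on k S (\<lambda>x. \<Sum>b\<in>Basis. (?D \<phi> x v \<bullet> b) *\<^sub>R ?D F (\<phi> x) b)" for v
    by (intro Ck_on_sum assms(1))
  have "Ck_on k S (\<lambda>x. ?D F (\<phi> x) (?D \<phi> x v))" for v
    by (rule Ck_on_cong[OF assms(1) _ sum]) (rule expand)
  then show ?case
    by (intro Ck_on_SucI[OF assms(1) der])
qed

lemma smooth_on_compose:
  assumes "open S" "\<phi> ` S \<subseteq> T" "smooth_on S \<phi>" "smooth_on T F"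
  shows "smooth_on S (\<lambda>x. F (\<phi> x))"
  using assms Ck_on_compose unfolding smooth_on_def by blast

lemma smooth_on_add:
  assumes "open S" "smooth_on S f" "smooth_on S g"
  shows "smooth_on S (\<lambda>x. f x + g x)"
  using assms Ck_on_add unfolding smooth_on_def by blast

lemma smooth_on_bounded_linear:
  assumes "open S" "bounded_linear L" "smooth_on S f"
  shows "smooth_on S (\<lambda>x. L (f x))"
  using assms Ck_on_bounded_linear unfolding smooth_on_def by blast

lemma smooth_on_imp_differentiable:
  assumes "smooth_on S f" "x \<in> S"
  shows "f differentiable (at x)"
  using assms unfolding smooth_on_def by (metis Ck_on.simps(2))

lemma smooth_on_frechet_derivative:
  assumes "smooth_on S f"
  shows "smooth_on S (\<lambda>x. frechet_derivative f (at x) v)"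
  using assms unfolding smooth_on_def by (metis Ck_on.simps(2))

section \<open>Derivatives of vector and matrix valued maps\<close>

lemma has_derivative_vec_iff:
  fixes f :: "'a::euclidean_space \<Rightarrow> real ^ 'n"
  shows "(f has_derivative f') (at x within S) \<longleftrightarrow>
    (\<forall>i. ((\<lambda>x. f x $ i) has_derivative (\<lambda>v. f' v $ i)) (at x within S))"
  by (subst has_derivative_componentwise_within) (simp add: Basis_vec_def inner_axis)

lemma differentiable_vec_iff:
  fixes f :: "'a::euclidean_space \<Rightarrow> real ^ 'n"
  shows "f differentiable (at x) \<longleftrightarrow> (\<forall>i. (\<lambda>x. f x $ i) differentiable (at x))"
proof
  assume "\<forall>i. (\<lambda>x. f x $ i) differentiable (at x)"
  then obtain D where "\<And>i. ((\<lambda>x. f x $ i) has_derivative D i) (at x)"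
    unfolding differentiable_def by metis
  then have "(f has_derivative (\<lambda>v. \<chi> i. D i v)) (at x)"
    by (subst has_derivative_vec_iff) simp
  then show "f differentiable (at x)"
    unfolding differentiable_def by blast
next
  assume "f differentiable (at x)"
  then show "\<forall>i. (\<lambda>x. f x $ i) differentiable (at x)"
    unfolding differentiable_def using has_derivative_vec_iff by metis
qed

lemma bounded_linear_matrix_entry: "bounded_linear (\<lambda>B::real ^ 'n ^ 'm. B $ i $ j)"
  by (rule bounded_linear_compose[OF bounded_linear_vec_nth bounded_linear_vec_nth])

lemma differentiable_matrix_iff:
  fixes A :: "'a::euclidean_space \<Rightarrow> real ^ 'n ^ 'm"
  shows "A differentiable (at x) \<longleftrightarrow> (\<forall>i j. (\<lambda>x. A x $ i $ j) differentiable (at x))"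
proof 
  assume "A differentiable (at x)"
  then show "\<forall>i j. (\<lambda>x. A x $ i $ j) differentiable (at x)"
    unfolding differentiable_def using bounded_linear.has_derivative[OF bounded_linear_matrix_entry]
    by blast
next
  assume "\<forall>i j. (\<lambda>x. A x $ i $ j) differentiable (at x)"
  then obtain D where D: "\<And>i j. ((\<lambda>x. A x $ i $ j) has_derivative D i j) (at x)"
    unfolding differentiable_def by metis
  have "(A has_derivative (\<lambda>v. \<chi> i j. D i j v)) (at x)"
    by (subst has_derivative_componentwise_within)
      (use D in \<open>auto simp: Basis_vec_def inner_axis\<close>)
  then show "A differentiable (at x)"
    unfolding differentiable_def by blast
qed

text \<open>At a zero of \<open>y\<close> the product rule loses the term that contains the derivative of \<open>A\<close>. Both
  the transformation of the Hessian at a critical point and the derivative of the critical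
  equation rest on this.\<close>

lemma has_derivative_matrix_vector_mult_zero:
  fixes A :: "'a::euclidean_space \<Rightarrow> real ^ 'n ^ 'm"
  assumes "A differentiable (at z)" "(y has_derivative y') (at z)" "y z = 0"
  shows "((\<lambda>z. A z *v y z) has_derivative (\<lambda>w. A z *v y' w)) (at z)"
proof (subst has_derivative_vec_iff, intro allI)
  fix i
  have *: "((\<lambda>z. A z $ i $ j * y z $ j) has_derivative (\<lambda>w. A z $ i $ j * y' w $ j)) (at z)" for j
  proof -
    have "(\<lambda>z. A z $ i $ j) differentiable (at z)"
      using assms(1) by (simp add: differentiable_matrix_iff)
    then obtain D where D: "((\<lambda>z. A z $ i $ j) has_derivative D) (at z)"
      unfolding differentiable_def by blast
    have y: "((\<lambda>z. y z $ j) has_derivative (\<lambda>w. y' w $ j)) (at z)"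
      using assms(2) has_derivative_vec_iff by blast
    show ?thesis
      using has_derivative_mult[OF D y] by (simp add: assms(3))
  qed
  show "((\<lambda>z. (A z *v y z) $ i) has_derivative (\<lambda>w. (A z *v y' w) $ i)) (at z)"
    unfolding matrix_vector_mult_def using has_derivative_sum[OF *] by simp
qed

lemma differentiable_det:
  fixes A :: "'a::euclidean_space \<Rightarrow> real ^ 'n ^ 'n"
  assumes "A differentiable (at x)"
  shows "(\<lambda>x. det (A x)) differentiable (at x)"
proof -
  have "\<forall>i j. (\<lambda>x. A x $ i $ j) differentiable (at x)"
    using assms by (simp add: differentiable_matrix_iff)
  then obtain D where "\<And>i j. ((\<lambda>x. A x $ i $ j) has_derivative D i j) (at x)"
    unfolding differentiable_def by metis
  then have "((\<lambda>x. \<Prod>i\<in>UNIV. A x $ i $ p i) has_derivative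
      (\<lambda>v. \<Sum>i\<in>UNIV. D i (p i) v * (\<Prod>j\<in>UNIV - {i}. A x $ j $ p j))) (at x)" for p :: "'n \<Rightarrow> 'n"
    by (intro has_derivative_prod)
  then have "(\<lambda>x. \<Prod>i\<in>UNIV. A x $ i $ p i) differentiable (at x)" for p :: "'n \<Rightarrow> 'n"
    using differentiableI by blast
  then show ?thesis
    unfolding det_def by (intro differentiable_sum differentiable_mult) auto
qed

text \<open>Solving linear systems by Cramer's rule exhibits the solution as a rational expression in
  the data, so that it depends differentiably on them.\<close>

definition cramer_solution :: "real ^ 'n ^ 'n \<Rightarrow> real ^ 'n \<Rightarrow> real ^ 'n"
  where "cramer_solution A r = (\<chi> k. det (\<chi> i j. if j = k then r $ i else A $ i $ j) / det A)"

lemma mult_cramer_solution: "det A \<noteq> 0 \<Longrightarrow> A *v cramer_solution A r = r"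
  using cramer unfolding cramer_solution_def by blast

lemma differentiable_cramer_solution:
  fixes A :: "'a::euclidean_space \<Rightarrow> real ^ 'n ^ 'n"
  assumes "A differentiable (at x)" "r differentiable (at x)" "det (A x) \<noteq> 0"
  shows "(\<lambda>x. cramer_solution (A x) (r x)) differentiable (at x)"
proof (subst differentiable_vec_iff, intro allI)
  fix k
  have "(\<lambda>x. (if j = k then r x $ i else A x $ i $ j)) differentiable (at x)" for i j
    using assms(1,2) by (cases "j = k") (simp_all add: differentiable_matrix_iff differentiable_vec_iff[of r])
  then have "(\<lambda>x. (\<chi> i j. if j = k then r x $ i else A x $ i $ j) :: real^'n^'n) differentiable (at x)"
    by (subst differentiable_matrix_iff) simp
  then show "(\<lambda>x. cramer_solution (A x) (r x) $ k) differentiable (at x)"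
    unfolding cramer_solution_def vec_lambda_beta
    by (intro differentiable_divide differentiable_det assms)
qed

lemma differentiable_transpose:
  fixes A :: "'a::euclidean_space \<Rightarrow> real ^ 'n ^ 'm"
  assumes "A differentiable (at x)"
  shows "(\<lambda>x. transpose (A x)) differentiable (at x)"
  using assms by (simp add: differentiable_matrix_iff transpose_def)

lemma differentiable_matrix_vector_mult:
  fixes A :: "'a::euclidean_space \<Rightarrow> real ^ 'n ^ 'm"
  assumes "A differentiable (at x)" "y differentiable (at x)"
  shows "(\<lambda>x. A x *v y x) differentiable (at x)"
  using assms unfolding differentiable_matrix_iff differentiable_vec_iff[of y]
  by (subst differentiable_vec_iff) (simp add: matrix_vector_mult_def)

lemma differentiable_matrix_mult_right:
  fixes A :: "'a::euclidean_space \<Rightarrow> real ^ 'n ^ 'm" and M :: "real ^ 'k ^ 'n"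
  assumes "A differentiable (at x)"
  shows "(\<lambda>x. A x ** M) differentiable (at x)"
  using assms unfolding differentiable_matrix_iff
  by (simp add: matrix_matrix_mult_def)

lemma det_eq_0_iff_kernel:
  fixes A :: "real ^ 'n ^ 'n"
  shows "det A = 0 \<longleftrightarrow> (\<exists>u. u \<noteq> 0 \<and> A *v u = 0)"
  by (metis invertible_det_nz invertible_left_inverse matrix_left_invertible_ker matrix_vector_mult_0_right)

text \<open>If \<open>M\<^sup>T M u = 0\<close> then \<open>|M u|\<^sup>2 = u \<bullet> M\<^sup>T M u = 0\<close>.\<close>

lemma transpose_mult_self_nonsingular:
  fixes M :: "real ^ 'n ^ 'm"
  assumes "inj ((*v) M)"
  shows "det (transpose M ** M) \<noteq> 0"
proof
  assume "det (transpose M ** M) = 0"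
  then obtain u where u: "u \<noteq> 0" "transpose M *v (M *v u) = 0"
    by (metis det_eq_0_iff_kernel matrix_vector_mul_assoc)
  have "(M *v u) \<bullet> (M *v u) = u \<bullet> (transpose M *v (M *v u))"
    by (metis dot_lmul_matrix inner_commute transpose_matrix_vector)
  then have "M *v u = M *v 0"
    using u(2) by simp
  then show False
    using assms u(1) by (metis injD)
qed

section \<open>Gradient and Hessian in coordinates\<close>

definition gradient :: "(real ^ 'n::finite \<Rightarrow> real) \<Rightarrow> real ^ 'n \<Rightarrow> real ^ 'n"
  where "gradient h x = (\<chi> j. frechet_derivative h (at x) (axis j 1))"

lemma linear_eq_inner_axis_values:
  fixes L :: "real ^ 'n \<Rightarrow> real"
  assumes "linear L"
  shows "L v = (\<chi> j. L (axis j 1)) \<bullet> v"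
proof -
  have "L v = L (\<Sum>j\<in>UNIV. (v $ j) *\<^sub>R axis j 1)"
    using basis_expansion[of v] by (simp add: scalar_mult_eq_scaleR)
  also have "\<dots> = (\<Sum>j\<in>UNIV. v $ j * L (axis j 1))"
    using assms by (simp add: linear_sum linear_cmul)
  finally show ?thesis by (simp add: inner_vec_def mult.commute)
qed

lemma gradient_works:
  assumes "h differentiable (at x)"
  shows "(h has_derivative (\<lambda>v. gradient h x \<bullet> v)) (at x)"
proof -
  have "frechet_derivative h (at x) = (\<lambda>v. gradient h x \<bullet> v)"
    using linear_eq_inner_axis_values[OF linear_frechet_derivative[OF assms]]
    unfolding gradient_def by blast
  then show ?thesis using assms frechet_derivative_works by metis
qed

lemma gradient_unique:
  assumes "(h has_derivative (\<lambda>v. g \<bullet> v)) (at x)"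
  shows "gradient h x = g"
  unfolding gradient_def using frechet_derivative_at[OF assms, symmetric]
  by (simp add: vec_eq_iff inner_axis)

lemma frechet_derivative_eq_0_iff_gradient:
  assumes "h differentiable (at x)"
  shows "frechet_derivative h (at x) = (\<lambda>v. 0) \<longleftrightarrow> gradient h x = 0"
proof -
  have *: "frechet_derivative h (at x) = (\<lambda>v. gradient h x \<bullet> v)"
    using frechet_derivative_at[OF gradient_works[OF assms]] by simp
  show ?thesis unfolding *
    by (metis inner_eq_zero_iff inner_zero_left)
qed

lemma gradient_compose:
  fixes \<tau> :: "real ^ 'n \<Rightarrow> real ^ 'm"
  assumes "\<tau> differentiable (at x)" "h differentiable (at (\<tau> x))"
  shows "gradient (\<lambda>y. h (\<tau> y)) x = transpose (jacobian \<tau> (at x)) *v gradient h (\<tau> x)"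
proof (rule gradient_unique)
  have "((\<lambda>y. h (\<tau> y)) has_derivative (\<lambda>v. gradient h (\<tau> x) \<bullet> (jacobian \<tau> (at x) *v v))) (at x)"
    using has_derivative_compose gradient_works[OF assms(2)] assms(1)[unfolded jacobian_works]
    by blast
  then show "((\<lambda>y. h (\<tau> y)) has_derivative
      (\<lambda>v. (transpose (jacobian \<tau> (at x)) *v gradient h (\<tau> x)) \<bullet> v)) (at x)"
    by (simp add: dot_lmul_matrix flip: vector_transpose_matrix)
qed

lemma gradient_add_inner:
  fixes \<phi> :: "real ^ 'n \<Rightarrow> real ^ 'm"
  assumes "h differentiable (at x)" "\<phi> differentiable (at x)"
  shows "gradient (\<lambda>y. h y + a \<bullet> \<phi> y) x = gradient h x + transpose (jacobian \<phi> (at x)) *v a"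
proof (rule gradient_unique)
  have "((\<lambda>y. h y + a \<bullet> \<phi> y) has_derivative
      (\<lambda>v. gradient h x \<bullet> v + a \<bullet> (jacobian \<phi> (at x) *v v))) (at x)"
    using has_derivative_add[OF gradient_works[OF assms(1)]
        has_derivative_inner_right[OF assms(2)[unfolded jacobian_works]]] .
  then show "((\<lambda>y. h y + a \<bullet> \<phi> y) has_derivative
      (\<lambda>v. (gradient h x + transpose (jacobian \<phi> (at x)) *v a) \<bullet> v)) (at x)"
    by (simp add: dot_lmul_matrix inner_add_left flip: vector_transpose_matrix)
qed

text \<open>The transpose comes from the index order in the definition of the Hessian: row \<open>i\<close> holds the
  derivatives in direction \<open>i\<close>. Keeping it avoids an appeal to the symmetry of second derivatives.\<close>

lemma gradient_has_derivative_hessian: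
  assumes "smooth_on S h" "x \<in> S"
  shows "(gradient h has_derivative (\<lambda>v. transpose (hessian h x) *v v)) (at x)"
proof (subst has_derivative_vec_iff, intro allI)
  fix j
  let ?D = "\<lambda>y. frechet_derivative h (at y) (axis j 1)"
  have "(?D has_derivative (\<lambda>v. gradient ?D x \<bullet> v)) (at x)"
    using smooth_on_imp_differentiable[OF smooth_on_frechet_derivative] assms
    by (blast intro: gradient_works)
  then show "((\<lambda>y. gradient h y $ j) has_derivative (\<lambda>v. (transpose (hessian h x) *v v) $ j)) (at x)"
    by (simp add: gradient_def hessian_def matrix_vector_mult_def transpose_def inner_vec_def)
qed

lemma hessian_eqI:
  assumes "smooth_on S h" "x \<in> S" "(gradient h has_derivative (\<lambda>v. H *v v)) (at x)"
  shows "transpose (hessian h x) = H"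
  using has_derivative_unique[OF gradient_has_derivative_hessian[OF assms(1,2)] assms(3)]
  by (metis matrix_eq)

lemma differentiable_jacobian:
  fixes \<phi> :: "real ^ 'n \<Rightarrow> real ^ 'm"
  assumes "smooth_on S \<phi>" "x \<in> S"
  shows "(\<lambda>y. jacobian \<phi> (at y)) differentiable (at x)"
proof (subst differentiable_matrix_iff, intro allI)
  fix i j
  have "(\<lambda>y. frechet_derivative \<phi> (at y) (axis j 1)) differentiable (at x)"
    using smooth_on_imp_differentiable[OF smooth_on_frechet_derivative] assms by blast
  then show "(\<lambda>y. jacobian \<phi> (at y) $ i $ j) differentiable (at x)"
    by (subst (asm) differentiable_vec_iff) (simp add: jacobian_def matrix_def)
qed

lemma gradient_cong:
  assumes "open S" "x \<in> S" "\<And>y. y \<in> S \<Longrightarrow> f y = g y" "f differentiable (at x)"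
  shows "gradient f x = gradient g x"
  unfolding gradient_def
  using frechet_derivative_transform_within_open[OF assms(4,1,2,3)] by simp

text \<open>By the chain rule the gradient picks up the factor \<open>J\<^sup>T\<close>. Differentiating once more would also
  bring in the second derivatives of \<open>\<tau>\<close>, but they are multiplied by the gradient, which
  vanishes at a critical point.\<close>

lemma gradient_hessian_change_of_coordinates:
  fixes \<tau> :: "real ^ 'n::finite \<Rightarrow> real ^ 'n"
  assumes S: "open S" "x \<in> S" and \<tau>: "smooth_on S \<tau>" "\<tau> ` S \<subseteq> T" and k: "smooth_on T k"
    and l: "smooth_on R l" "S \<subseteq> R" and eq: "\<And>y. y \<in> S \<Longrightarrow> l y = k (\<tau> y)"
  defines "J \<equiv> jacobian \<tau> (at x)"
  shows "gradient l x = transpose J *v gradient k (\<tau> x)"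
    and "gradient k (\<tau> x) = 0 \<Longrightarrow>
      transpose (hessian l x) = transpose J ** transpose (hessian k (\<tau> x)) ** J"
proof -
  have diff: "\<tau> differentiable (at y)" "k differentiable (at (\<tau> y))" "l differentiable (at y)"
    if "y \<in> S" for y
    using that \<tau> k l smooth_on_imp_differentiable by blast+
  have grad: "gradient l y = transpose (jacobian \<tau> (at y)) *v gradient k (\<tau> y)" if "y \<in> S" for y
    using gradient_cong[OF S(1) that eq diff(3)[OF that]] gradient_compose[OF diff(1)[OF that] diff(2)[OF that]]
    by simp
  then show "gradient l x = transpose J *v gradient k (\<tau> x)"
    unfolding J_def using S(2) by blast
  assume zero: "gradient k (\<tau> x) = 0"
  have "(\<tau> has_derivative (\<lambda>v. J *v v)) (at x)"
    unfolding J_def using diff(1)[OF S(2)] jacobian_works by blast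
  moreover have "(gradient k has_derivative (\<lambda>v. transpose (hessian k (\<tau> x)) *v v)) (at (\<tau> x))"
    using gradient_has_derivative_hessian[OF k] \<tau>(2) S(2) by blast
  ultimately have "((\<lambda>y. gradient k (\<tau> y)) has_derivative
      (\<lambda>v. transpose (hessian k (\<tau> x)) *v (J *v v))) (at x)"
    by (rule has_derivative_compose)
  then have "((\<lambda>y. transpose (jacobian \<tau> (at y)) *v gradient k (\<tau> y)) has_derivative
      (\<lambda>v. transpose J *v (transpose (hessian k (\<tau> x)) *v (J *v v)))) (at x)"
    unfolding J_def using zero
    by (intro has_derivative_matrix_vector_mult_zero differentiable_transpose
        differentiable_jacobian[OF \<tau>(1) S(2)])
  then have "(gradient l has_derivative
      (\<lambda>v. transpose J *v (transpose (hessian k (\<tau> x)) *v (J *v v)))) (at x)"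
    by (rule has_derivative_transform_within_open[OF _ S]) (simp add: grad)
  then show "transpose (hessian l x) = transpose J ** transpose (hessian k (\<tau> x)) ** J"
    using l S(2) by (intro hessian_eqI[of R]) (auto simp: matrix_vector_mul_assoc matrix_mul_assoc simp del: transpose_matrix_vector)
qed

lemma det_jacobian_nonzero:
  fixes \<tau> \<sigma> :: "real ^ 'n::finite \<Rightarrow> real ^ 'n"
  assumes "open S" "x \<in> S" "\<And>y. y \<in> S \<Longrightarrow> \<sigma> (\<tau> y) = y"
    and "\<tau> differentiable (at x)" "\<sigma> differentiable (at (\<tau> x))"
  shows "det (jacobian \<tau> (at x)) \<noteq> 0"
proof -
  have "((\<lambda>y. \<sigma> (\<tau> y)) has_derivative
      (\<lambda>v. jacobian \<sigma> (at (\<tau> x)) *v (jacobian \<tau> (at x) *v v))) (at x)"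
    using assms(4,5) unfolding jacobian_works by (rule has_derivative_compose)
  moreover have "((\<lambda>y. \<sigma> (\<tau> y)) has_derivative (\<lambda>v. v)) (at x)"
    by (rule has_derivative_transform_within_open[OF has_derivative_ident assms(1,2)])
      (simp add: assms(3))
  ultimately have *: "(\<lambda>v. jacobian \<sigma> (at (\<tau> x)) *v (jacobian \<tau> (at x) *v v)) = (\<lambda>v. v)"
    by (rule has_derivative_unique)
  have "u = 0" if "jacobian \<tau> (at x) *v u = 0" for u
    using fun_cong[OF *, of u] that by simp
  then show ?thesis
    using det_eq_0_iff_kernel by blast
qed

section \<open>Degenerate linear perturbations near a point of immersion\<close>

text \<open>The local form of the theorem. The set of bad parameters is contained in the image under
  \<open>\<Psi>\<close> of points where the derivative of \<open>\<Psi>\<close> is singular, with \<open>\<Psi>\<close> the second component of the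
  parametrization of critical pairs described at the beginning.\<close>

lemma degenerate_parameters_locally_negligible:
  fixes h :: "real ^ 'n::finite \<Rightarrow> real" and \<phi> :: "real ^ 'n \<Rightarrow> real ^ 'm::finite"
  assumes W: "open W" "x0 \<in> W" and h: "smooth_on W h" and \<phi>: "smooth_on W \<phi>"
    and inj: "inj (frechet_derivative \<phi> (at x0))"
  shows "\<exists>V. open V \<and> x0 \<in> V \<and> V \<subseteq> W \<and>
    negligible {a. \<exists>x\<in>V. gradient (\<lambda>y. h y + a \<bullet> \<phi> y) x = 0 \<and>
      det (hessian (\<lambda>y. h y + a \<bullet> \<phi> y) x) = 0}"
proof -
  define J where "J x = jacobian \<phi> (at x)" for x
  define M where "M = J x0"
  define B where "B x = transpose (J x) ** M" for x
  define g where "g a y = h y + a \<bullet> \<phi> y" for a y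
  have diff: "h differentiable (at x)" "\<phi> differentiable (at x)"
    "gradient h differentiable (at x)" "J differentiable (at x)" if "x \<in> W" for x
    using that h \<phi> smooth_on_imp_differentiable differentiable_jacobian[OF \<phi>]
      gradient_has_derivative_hessian[OF h] differentiableI
    unfolding J_def by blast+
  have g: "smooth_on W (g a)" for a
    unfolding g_def
    by (intro smooth_on_add smooth_on_bounded_linear[OF _ bounded_linear_inner_right] W h \<phi>)
  have grad_g: "gradient (g a) x = gradient h x + transpose (J x) *v a" if "x \<in> W" for a x
    unfolding g_def J_def by (rule gradient_add_inner) (use diff that in auto)

  have "frechet_derivative \<phi> (at x0) = (*v) M"
    using diff(2)[OF W(2)] frechet_derivative_at
    unfolding jacobian_works M_def J_def by metis
  then have "det (B x0) \<noteq> 0"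
    unfolding B_def using inj M_def transpose_mult_self_nonsingular by metis
  then obtain N where N: "B x0 ** N = mat 1" "N ** B x0 = mat 1"
    using invertible_det_nz unfolding invertible_def by blast
  have B0: "transpose M *v (M *v u) = B x0 *v u" for u
    by (simp add: B_def M_def matrix_vector_mul_assoc)
  have MMN: "transpose M *v (M *v (N *v u)) = u" for u
    unfolding B0 by (simp add: matrix_vector_mul_assoc N)

  \<comment> \<open>On \<open>V\<close> the critical equation can be solved for the component of the parameter in the range of \<open>M\<close>.\<close>
  define V where "V = {x\<in>W. det (B x) \<noteq> 0}"
  have diffB: "B differentiable (at x)" if "x \<in> W" for x
    unfolding B_def
    by (intro differentiable_matrix_mult_right differentiable_transpose diff that)
  have "continuous_on W (\<lambda>x. det (B x))"
    using differentiable_det[OF diffB]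
    by (blast intro: continuous_at_imp_continuous_on differentiable_imp_continuous_within)
  then have "open (W \<inter> (\<lambda>x. det (B x)) -` (- {0}))"
    by (intro continuous_open_preimage W) auto
  moreover have "V = W \<inter> (\<lambda>x. det (B x)) -` (- {0})"
    unfolding V_def by auto
  ultimately have V: "open V" "x0 \<in> V" "V \<subseteq> W"
    using V_def W(2) \<open>det (B x0) \<noteq> 0\<close> by auto

  \<comment> \<open>\<open>K\<close> is the orthogonal projection onto the kernel of \<open>M\<^sup>T\<close>, and \<open>\<Psi> z\<close> is the
    parameter with \<open>K\<close>-component \<open>K z\<close> for which \<open>\<xi> z\<close> is a critical point.\<close>
  define \<xi> where "\<xi> z = x0 + transpose M *v z" for z
  define K where "K z = z - M *v (N *v (transpose M *v z))" for z
  define r where "r z = - (gradient h (\<xi> z) + transpose (J (\<xi> z)) *v K z)" for z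
  define C where "C z = cramer_solution (B (\<xi> z)) (r z)" for z
  define \<Psi> where "\<Psi> z = K z + M *v C z" for z
  have "linear K"
    by (rule linearI)
      (simp_all add: K_def matrix_vector_right_distrib matrix_vector_mult_scaleR scaleR_diff_right)
  then have K: "(K has_derivative K) (at z)" for z
    by (simp add: linear_imp_has_derivative)
  have \<xi>: "(\<xi> has_derivative (\<lambda>w. transpose M *v w)) (at z)" for z
    unfolding \<xi>_def
    using has_derivative_add[OF has_derivative_const[of x0]
        linear_imp_has_derivative[OF matrix_vector_mul_linear[of "transpose M"]]]
    by simp
  have \<xi>_diff: "\<xi> differentiable (at z)" for z
    using \<xi> differentiableI by blast
  have critical: "gradient h (\<xi> z) + transpose (J (\<xi> z)) *v \<Psi> z = 0" if "\<xi> z \<in> V" for z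
  proof -
    have "transpose (J (\<xi> z)) *v (M *v C z) = r z"
      using mult_cramer_solution[of "B (\<xi> z)" "r z"] that
      by (simp add: V_def C_def B_def matrix_vector_mul_assoc)
    then show ?thesis
      by (simp add: \<Psi>_def r_def matrix_vector_right_distrib)
  qed
  have C: "C differentiable (at z)" if "\<xi> z \<in> V" for z
  proof -
    have W: "\<xi> z \<in> W" using that V by blast
    have "(\<lambda>z. transpose (J (\<xi> z))) differentiable (at z)"
      using differentiable_compose[OF diff(4)[OF W] \<xi>_diff] by (intro differentiable_transpose)
    moreover have "(\<lambda>z. gradient h (\<xi> z)) differentiable (at z)"
      using differentiable_compose[OF diff(3)[OF W] \<xi>_diff] .
    moreover have "K differentiable (at z)"
      using K differentiableI by blast
    ultimately have "r differentiable (at z)"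
      unfolding r_def
      by (intro differentiable_minus differentiable_add differentiable_matrix_vector_mult)
    moreover have "(\<lambda>z. B (\<xi> z)) differentiable (at z)"
      using differentiable_compose[OF diffB[OF W] \<xi>_diff] .
    ultimately show ?thesis
      unfolding C_def using that V_def by (intro differentiable_cramer_solution) auto
  qed

  define S where "S = {z. \<xi> z \<in> V \<and> det (hessian (g (\<Psi> z)) (\<xi> z)) = 0}"
  define D where "D z = frechet_derivative \<Psi> (at z)" for z
  have \<Psi>_deriv: "\<exists>C'. (\<Psi> has_derivative (\<lambda>w. K w + M *v C' w)) (at z)" if zV: "\<xi> z \<in> V" for z
  proof -
    obtain C' where "(C has_derivative C') (at z)"
      using C[OF zV] unfolding differentiable_def by blast
    then have "((\<lambda>z. M *v C z) has_derivative (\<lambda>w. M *v C' w)) (at z)"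
      using has_derivative_compose linear_imp_has_derivative[OF matrix_vector_mul_linear] by blast
    then show ?thesis
      unfolding \<Psi>_def using has_derivative_add[OF K] by blast
  qed
  have "negligible (\<Psi> ` S)"
  proof (rule Sard_equidimensional)
    fix z assume z: "z \<in> S"
    then have zV: "\<xi> z \<in> V" and zW: "\<xi> z \<in> W" using S_def V by auto
    obtain C' where C': "(\<Psi> has_derivative (\<lambda>w. K w + M *v C' w)) (at z)"
      using \<Psi>_deriv[OF zV] by blast
    then have D: "D z = (\<lambda>w. K w + M *v C' w)"
      unfolding D_def using frechet_derivative_at by metis
    show "(\<Psi> has_derivative D z) (at z within S)"
      unfolding D using C' has_derivative_at_withinI by blast
    define H where "H = transpose (hessian (g (\<Psi> z)) (\<xi> z))"
    have "det H = 0" using z by (simp add: S_def H_def det_transpose)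
    then obtain u where u: "u \<noteq> 0" "H *v u = 0"
      by (metis det_eq_0_iff_kernel)
    \<comment> \<open>The direction \<open>w\<close> moves the critical point along \<open>u\<close> without changing the
      component in the kernel of \<open>M\<^sup>T\<close>.\<close>
    define w where "w = M *v (N *v u)"
    have w: "transpose M *v w = u" and Kw: "K w = 0"
      unfolding w_def K_def MMN by simp_all
    \<comment> \<open>By \<open>grad_g\<close>, \<open>E z'\<close> is the gradient of \<open>g (\<Psi> z')\<close> at \<open>\<xi> z'\<close>, hence zero for \<open>z'\<close> near \<open>z\<close>. Writing it
      around the fixed parameter \<open>\<Psi> z\<close> separates the Hessian from the derivative of \<open>\<Psi>\<close>.\<close>
    define E where "E z' = gradient (g (\<Psi> z)) (\<xi> z') + transpose (J (\<xi> z')) *v (\<Psi> z' - \<Psi> z)" for z'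
    have E: "(E has_derivative (\<lambda>v. H *v (transpose M *v v) + transpose (J (\<xi> z)) *v (D z v))) (at z)"
      unfolding E_def
    proof (rule has_derivative_add)
      show "((\<lambda>z'. gradient (g (\<Psi> z)) (\<xi> z')) has_derivative (\<lambda>v. H *v (transpose M *v v))) (at z)"
        using has_derivative_compose[OF \<xi> gradient_has_derivative_hessian[OF g zW]]
        unfolding H_def .
      have "(\<lambda>z. transpose (J (\<xi> z))) differentiable (at z)"
        using differentiable_compose[OF diff(4)[OF zW] \<xi>_diff] by (intro differentiable_transpose)
      moreover have "((\<lambda>z'. \<Psi> z' - \<Psi> z) has_derivative D z) (at z)"
        using has_derivative_diff[OF C' has_derivative_const] by (simp add: D)
      ultimately show "((\<lambda>z'. transpose (J (\<xi> z')) *v (\<Psi> z' - \<Psi> z)) has_derivative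
          (\<lambda>v. transpose (J (\<xi> z)) *v D z v)) (at z)"
        by (rule has_derivative_matrix_vector_mult_zero) simp
    qed
    have E0: "(E has_derivative (\<lambda>v. 0)) (at z)"
    proof (rule has_derivative_transform_within_open[OF has_derivative_const])
      show "open (\<xi> -` V)"
        using V(1) \<xi> has_derivative_continuous
        by (intro open_vimage continuous_at_imp_continuous_on) blast+
      show "z \<in> \<xi> -` V" using zV by simp
      show "0 = E z'" if "z' \<in> \<xi> -` V" for z'
        using critical[of z'] grad_g[of "\<xi> z'" "\<Psi> z"] that V(3)
        by (auto simp: E_def matrix_vector_mult_diff_distrib)
    qed
    have "H *v (transpose M *v w) + transpose (J (\<xi> z)) *v (D z w) = 0"
      using fun_cong[OF has_derivative_unique[OF E E0]] .
    then have "B (\<xi> z) *v C' w = 0"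
      unfolding w u(2) by (simp add: D Kw B_def del: transpose_matrix_vector flip: matrix_vector_mul_assoc)
    then have "C' w = 0"
      using zV det_eq_0_iff_kernel unfolding V_def by blast
    then have "D z w = D z 0"
      using linear_0[OF has_derivative_linear[OF C']] by (simp add: D Kw)
    moreover have "w \<noteq> 0" using w u(1) by auto
    ultimately show "\<not> inj (D z)" by (metis injD)
  qed
  moreover have "{a. \<exists>x\<in>V. gradient (g a) x = 0 \<and> det (hessian (g a) x) = 0} \<subseteq> \<Psi> ` S"
  proof clarify
    fix a x assume x: "x \<in> V" "gradient (g a) x = 0" "det (hessian (g a) x) = 0"
    \<comment> \<open>The first summand makes \<open>\<xi> z = x\<close> and is annihilated by \<open>K\<close>; the second one
      prescribes the component of \<open>\<Psi> z\<close> in the kernel of \<open>M\<^sup>T\<close>.\<close>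
    define z where "z = M *v (N *v (x - x0)) + K a"
    have "transpose M *v K a = 0"
      by (simp add: K_def matrix_vector_mult_diff_distrib MMN del: transpose_matrix_vector)
    then have \<xi>z: "\<xi> z = x" and Kz: "K z = K a"
      by (simp_all add: z_def \<xi>_def K_def[of "_ + _"] matrix_vector_right_distrib MMN
          del: transpose_matrix_vector)
    define c where "c = N *v (transpose M *v a)"
    have a: "a = K a + M *v c" by (simp add: K_def c_def)
    have "gradient h x + transpose (J x) *v (K a + M *v c) = 0"
      using grad_g x V(3) a by auto
    moreover have "gradient h x + transpose (J x) *v (K a + M *v C z) = 0"
      using critical[of z] x(1) unfolding \<Psi>_def \<xi>z Kz by blast
    ultimately have "transpose (J x) *v (K a + M *v c) = transpose (J x) *v (K a + M *v C z)"
      by (metis add_left_cancel)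
    then have "B x *v c = B x *v C z"
      by (simp add: matrix_vector_right_distrib B_def del: transpose_matrix_vector
          flip: matrix_vector_mul_assoc)
    then have "B x *v (c - C z) = 0"
      by (simp add: matrix_vector_mult_diff_distrib)
    then have "c - C z = 0"
      using x(1) det_eq_0_iff_kernel unfolding V_def by blast
    then have "\<Psi> z = a"
      using a by (simp add: \<Psi>_def Kz)
    then show "a \<in> \<Psi> ` S"
      using x \<xi>z S_def by auto
  qed
  ultimately have "negligible {a. \<exists>x\<in>V. gradient (g a) x = 0 \<and> det (hessian (g a) x) = 0}"
    using negligible_subset by blast
  then show ?thesis
    using V unfolding g_def by blast
qed

section \<open>Change of charts\<close>

lemma chart_inv_left:
  assumes "is_chart X c" "p \<in> fst c"
  shows "chart_inv c (snd c p) = p"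
proof -
  have "topspace (subtopology X (fst c)) = fst c"
    using assms(1) openin_subset unfolding is_chart_def by fastforce
  then have "inj_on (snd c) (fst c)"
    using assms(1) homeomorphic_imp_injective_map unfolding is_chart_def by metis
  then show ?thesis
    unfolding chart_inv_def using assms(2) by (rule inv_into_f_f)
qed

lemma open_chart_image:
  assumes "is_chart X c" "openin X P" "P \<subseteq> fst c"
  shows "open (snd c ` P)"
proof -
  have "open_map (subtopology X (fst c)) (top_of_set (snd c ` fst c)) (snd c)"
    using assms(1) homeomorphic_imp_open_map unfolding is_chart_def by blast
  moreover have "openin (subtopology X (fst c)) P"
    using assms by (simp add: openin_open_subtopology is_chart_def)
  ultimately have "openin (top_of_set (snd c ` fst c)) (snd c ` P)"
    unfolding open_map_def by blast
  then show ?thesis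
    using assms(1) openin_open_trans unfolding is_chart_def by blast
qed

lemma openin_chart_vimage:
  assumes "is_chart X c" "open V"
  shows "openin X {p \<in> fst c. snd c p \<in> V}"
proof -
  have "topspace (subtopology X (fst c)) = fst c"
    using assms(1) openin_subset unfolding is_chart_def by fastforce
  moreover have "continuous_map (subtopology X (fst c)) euclidean (snd c)"
    using assms(1) homeomorphic_imp_continuous_map continuous_map_into_fulltopology
    unfolding is_chart_def by blast
  ultimately have "openin (subtopology X (fst c)) {p \<in> fst c. snd c p \<in> V}"
    using openin_continuous_map_preimage[of "subtopology X (fst c)" euclidean "snd c" V] assms(2)
    by simp
  then show ?thesis
    using assms(1) openin_trans_full unfolding is_chart_def by blast
qed

text \<open>Being a critical point is required in some chart and nondegeneracy in every chart, while
  the negligible sets below are controlled in a single chart around each point. The change of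
  coordinates formula connects them, since the Jacobian of a transition map is invertible.\<close>

lemma critical_nondegenerate_change_of_chart:
  fixes A :: "('a, 'n::finite) chart set" and g :: "'a \<Rightarrow> real"
  assumes X: "smooth_manifold X A" and g: "smooth_map A g"
    and c: "c \<in> A" "p \<in> fst c" and d: "d \<in> A" "p \<in> fst d"
    and crit: "gradient (g \<circ> chart_inv c) (snd c p) = 0"
  shows "gradient (g \<circ> chart_inv d) (snd d p) = 0"
    and "det (hessian (g \<circ> chart_inv c) (snd c p)) \<noteq> 0 \<Longrightarrow>
      det (hessian (g \<circ> chart_inv d) (snd d p)) \<noteq> 0"
proof -
  define Q where "Q = fst d \<inter> fst c"
  define \<tau> where "\<tau> = snd c \<circ> chart_inv d"
  define \<sigma> where "\<sigma> = snd d \<circ> chart_inv c"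
  define J where "J = jacobian \<tau> (at (snd d p))"
  have charts: "is_chart X c" "is_chart X d"
    using X c d unfolding smooth_manifold_def by auto
  then have "openin X Q"
    unfolding Q_def is_chart_def by blast
  then have op: "open (snd d ` Q)"
    using open_chart_image[OF charts(2)] Q_def by blast
  have p: "snd d p \<in> snd d ` Q" "snd c p \<in> snd c ` Q" using c d Q_def by auto
  have \<tau>: "\<tau> (snd d q) = snd c q" and \<sigma>: "\<sigma> (snd c q) = snd d q" if "q \<in> Q" for q
    using that charts unfolding \<tau>_def \<sigma>_def Q_def by (simp_all add: chart_inv_left)
  have sm\<tau>: "smooth_on (snd d ` Q) \<tau>" and sm\<sigma>: "smooth_on (snd c ` Q) \<sigma>"
    using X c d unfolding smooth_manifold_def \<tau>_def \<sigma>_def Q_def by (auto simp: Int_commute)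
  have im: "\<tau> ` snd d ` Q \<subseteq> snd c ` fst c"
    using \<tau> unfolding Q_def by auto
  have smc: "smooth_on (snd c ` fst c) (g \<circ> chart_inv c)"
    and smd: "smooth_on (snd d ` fst d) (g \<circ> chart_inv d)"
    using g c d unfolding smooth_map_def by auto
  have sub: "snd d ` Q \<subseteq> snd d ` fst d" unfolding Q_def by auto
  have eq: "(g \<circ> chart_inv d) y = (g \<circ> chart_inv c) (\<tau> y)" if "y \<in> snd d ` Q" for y
    using that charts \<tau> unfolding Q_def by (auto simp: chart_inv_left)
  have \<tau>p: "\<tau> (snd d p) = snd c p" using \<tau> c d Q_def by blast
  note change = gradient_hessian_change_of_coordinates[OF op p(1) sm\<tau> im smc smd sub eq, folded J_def,
      unfolded \<tau>p]
  show "gradient (g \<circ> chart_inv d) (snd d p) = 0"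
    using change(1) crit by (simp add: o_def)
  assume nd: "det (hessian (g \<circ> chart_inv c) (snd c p)) \<noteq> 0"
  have hess: "transpose (hessian (g \<circ> chart_inv d) (snd d p)) =
      transpose J ** transpose (hessian (g \<circ> chart_inv c) (snd c p)) ** J"
    using change(2) crit by blast
  have "det J \<noteq> 0"
    unfolding J_def
  proof (rule det_jacobian_nonzero[OF op p(1)])
    show "\<sigma> (\<tau> y) = y" if "y \<in> snd d ` Q" for y
      using that \<tau> \<sigma> by auto
    show "\<tau> differentiable (at (snd d p))"
      using smooth_on_imp_differentiable[OF sm\<tau> p(1)] .
    show "\<sigma> differentiable (at (\<tau> (snd d p)))"
      unfolding \<tau>p using smooth_on_imp_differentiable[OF sm\<sigma> p(2)] .
  qed
  then show "det (hessian (g \<circ> chart_inv d) (snd d p)) \<noteq> 0"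
    using nd hess by (metis det_mul det_transpose mult_eq_0_iff)
qed

lemma critical_point_iff_gradient:
  assumes "smooth_map A g" "c \<in> A" "p \<in> fst c"
  shows "chart_differential c g p = (\<lambda>v. 0) \<longleftrightarrow> gradient (g \<circ> chart_inv c) (snd c p) = 0"
proof -
  have "(g \<circ> chart_inv c) differentiable (at (snd c p))"
    using assms smooth_on_imp_differentiable unfolding smooth_map_def by blast
  then show ?thesis
    unfolding chart_differential_def by (rule frechet_derivative_eq_0_iff_gradient)
qed

section \<open>Generic linear perturbations on a manifold\<close>

text \<open>Linear forms are represented by their coefficient vectors.\<close>

definition degenerate_forms ::
  "('a, 'n::finite) chart \<Rightarrow> (real ^ 'm::finite \<Rightarrow> real) \<Rightarrow> ('a \<Rightarrow> real ^ 'm) \<Rightarrow> 'a set \<Rightarrow> (real ^ 'm) set"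
  where "degenerate_forms c F f P =
    {a. \<exists>q\<in>P. gradient (perturb F (\<lambda>x. a \<bullet> x) \<circ> f \<circ> chart_inv c) (snd c q) = 0 \<and>
      det (hessian (perturb F (\<lambda>x. a \<bullet> x) \<circ> f \<circ> chart_inv c) (snd c q)) = 0}"

lemma smooth_on_immersion_chart:
  fixes A :: "('a, 'n::finite) chart set" and U :: "(real ^ 'm::finite) set" and F :: "real ^ 'm \<Rightarrow> real"
  assumes "smooth_manifold X A" "immersion_into X A U f" "smooth_on U F" "c \<in> A"
  shows "open (snd c ` fst c)" and "smooth_on (snd c ` fst c) (f \<circ> chart_inv c)"
    and "smooth_on (snd c ` fst c) (F \<circ> (f \<circ> chart_inv c))"
proof -
  have chart: "is_chart X c"
    using assms(1,4) unfolding smooth_manifold_def by blast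
  then show op: "open (snd c ` fst c)"
    unfolding is_chart_def by blast
  show f: "smooth_on (snd c ` fst c) (f \<circ> chart_inv c)"
    using assms(2,4) unfolding immersion_into_def smooth_map_def by blast
  have "fst c \<subseteq> topspace X"
    using chart openin_subset unfolding is_chart_def by blast
  then have "(f \<circ> chart_inv c) ` (snd c ` fst c) \<subseteq> U"
    using assms(2) chart unfolding immersion_into_def by (fastforce simp: chart_inv_left)
  then show "smooth_on (snd c ` fst c) (F \<circ> (f \<circ> chart_inv c))"
    unfolding comp_def[of F] by (intro smooth_on_compose[OF op _ f assms(3)])
qed

lemma smooth_map_perturb:
  fixes A :: "('a, 'n::finite) chart set" and U :: "(real ^ 'm::finite) set" and F :: "real ^ 'm \<Rightarrow> real"
  assumes "smooth_manifold X A" "immersion_into X A U f" "smooth_on U F"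
  shows "smooth_map A (perturb F (\<lambda>x. a \<bullet> x) \<circ> f)"
  unfolding smooth_map_def
proof
  fix c assume c: "c \<in> A"
  have "smooth_on (snd c ` fst c) (\<lambda>y. F (f (chart_inv c y)) + a \<bullet> f (chart_inv c y))"
    using smooth_on_immersion_chart[OF assms c]
    by (intro smooth_on_add smooth_on_bounded_linear[OF _ bounded_linear_inner_right])
      (simp_all add: o_def)
  then show "smooth_on (snd c ` fst c) (perturb F (\<lambda>x. a \<bullet> x) \<circ> f \<circ> chart_inv c)"
    by (simp add: perturb_def o_def)
qed

lemma degenerate_forms_locally_negligible:
  fixes A :: "('a, 'n::finite) chart set" and U :: "(real ^ 'm::finite) set" and F :: "real ^ 'm \<Rightarrow> real"
  assumes X: "smooth_manifold X A" and f: "immersion_into X A U f" and F: "smooth_on U F"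
    and p: "p \<in> topspace X"
  shows "\<exists>c\<in>A. \<exists>P. openin X P \<and> p \<in> P \<and> P \<subseteq> fst c \<and> negligible (degenerate_forms c F f P)"
proof -
  obtain c where c: "c \<in> A" "p \<in> fst c"
    using X p unfolding smooth_manifold_def by blast
  have chart: "is_chart X c"
    using X c unfolding smooth_manifold_def by blast
  have "inj (frechet_derivative (f \<circ> chart_inv c) (at (snd c p)))"
    using f c unfolding immersion_into_def chart_differential_def by blast
  then obtain V where V: "open V" "snd c p \<in> V" and
    neg: "negligible {a. \<exists>x\<in>V.
      gradient (\<lambda>y. (F \<circ> (f \<circ> chart_inv c)) y + a \<bullet> (f \<circ> chart_inv c) y) x = 0 \<and>
      det (hessian (\<lambda>y. (F \<circ> (f \<circ> chart_inv c)) y + a \<bullet> (f \<circ> chart_inv c) y) x) = 0}"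
    using degenerate_parameters_locally_negligible[OF smooth_on_immersion_chart(1)[OF X f F c(1)] _
        smooth_on_immersion_chart(3,2)[OF X f F c(1)]] c(2) by blast
  let ?P = "{q \<in> fst c. snd c q \<in> V}"
  have "negligible (degenerate_forms c F f ?P)"
    using neg by (rule negligible_subset) (auto simp: degenerate_forms_def perturb_def o_def)
  then show ?thesis
    using openin_chart_vimage[OF chart V(1)] V(2) c by blast
qed

lemma linear_form_eq_inner_form_coords:
  "\<pi> \<in> linear_forms \<Longrightarrow> \<pi> = (\<lambda>x. form_coords \<pi> \<bullet> x)"
  unfolding linear_forms_def form_coords_def using linear_eq_inner_axis_values by blast

text \<open>The atlas may be uncountable, so the exceptional set is the union of the bad sets over a
  countable family of neighbourhoods, each judged in one chart chosen for it. A form outside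
  this set has only nondegenerate critical points in the chosen charts, and the change of charts
  lemma carries the property from the chart in which the point is critical to the chosen one and
  from there to every other.\<close>

theorem corollary1:
  fixes X :: "'a topology" and A :: "('a, 'n::finite) chart set"
    and U :: "(real ^ 'm::finite) set"
    and f :: "'a \<Rightarrow> real ^ 'm" and F :: "real ^ 'm \<Rightarrow> real"
  assumes "smooth_manifold X A"
    and "open U"
    and "immersion_into X A U f"
    and "smooth_on U F"
  shows "\<exists>\<Sigma>. null_forms \<Sigma> \<and>
    (\<forall>\<pi>\<in>linear_forms - \<Sigma>. Morse_function X A (perturb F \<pi> \<circ> f))"
proof -
  define \<U> where "\<U> = {P. openin X P \<and>
    (\<exists>c. c \<in> A \<and> P \<subseteq> fst c \<and> negligible (degenerate_forms c F f P))}"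
  have "Lindelof_space X"
    using assms(1) second_countable_imp_Lindelof_space unfolding smooth_manifold_def by blast
  moreover have "\<And>P. P \<in> \<U> \<Longrightarrow> openin X P"
    unfolding \<U>_def by blast
  moreover have "\<Union>\<U> = topspace X"
  proof
    show "\<Union>\<U> \<subseteq> topspace X"
      using openin_subset unfolding \<U>_def by blast
    show "topspace X \<subseteq> \<Union>\<U>"
      using degenerate_forms_locally_negligible[OF assms(1,3,4)] unfolding \<U>_def by blast
  qed
  ultimately have "\<exists>\<V>. countable \<V> \<and> \<V> \<subseteq> \<U> \<and> \<Union>\<V> = topspace X"
    by (rule Lindelof_spaceD)
  then obtain \<V> where \<V>: "countable \<V>" "\<V> \<subseteq> \<U>" "\<Union>\<V> = topspace X"
    by (elim exE conjE)
  have "\<forall>P\<in>\<V>. \<exists>c. c \<in> A \<and> P \<subseteq> fst c \<and> negligible (degenerate_forms c F f P)"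
    using \<V>(2) unfolding \<U>_def by blast
  then obtain ch where "\<forall>P\<in>\<V>. ch P \<in> A \<and> P \<subseteq> fst (ch P) \<and>
      negligible (degenerate_forms (ch P) F f P)"
    by (rule bchoice[THEN exE])
  then have ch: "ch P \<in> A" "P \<subseteq> fst (ch P)" "negligible (degenerate_forms (ch P) F f P)"
    if "P \<in> \<V>" for P
    using that by blast+
  define B where "B = (\<Union>P\<in>\<V>. degenerate_forms (ch P) F f P)"
  have "negligible B"
    unfolding B_def using \<V>(1) ch by (intro negligible_countable_Union) auto
  define \<Sigma> where "\<Sigma> = {\<pi> \<in> linear_forms. form_coords \<pi> \<in> B}"
  have "null_forms \<Sigma>"
    unfolding null_forms_def
  proof
    show "\<Sigma> \<subseteq> linear_forms" unfolding \<Sigma>_def by blast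
    have "form_coords ` \<Sigma> \<subseteq> B" unfolding \<Sigma>_def by blast
    then show "form_coords ` \<Sigma> \<in> null_sets lebesgue"
      using \<open>negligible B\<close> negligible_subset negligible_iff_null_sets by blast
  qed
  moreover have "Morse_function X A (perturb F \<pi> \<circ> f)" if \<pi>: "\<pi> \<in> linear_forms - \<Sigma>" for \<pi>
  proof -
    define a where "a = form_coords \<pi>"
    define g where "g = perturb F (\<lambda>x. a \<bullet> x) \<circ> f"
    have "\<pi> = (\<lambda>x. a \<bullet> x)"
      using \<pi> linear_form_eq_inner_form_coords unfolding a_def by blast
    then have g_eq: "perturb F \<pi> \<circ> f = g" unfolding g_def by simp
    have "a \<notin> B" using \<pi> unfolding a_def \<Sigma>_def by blast
    have g: "smooth_map A g"
      unfolding g_def by (rule smooth_map_perturb[OF assms(1,3,4)])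
    have "nondegenerate_at A g p" if p: "p \<in> topspace X" and crit: "critical_point A g p" for p
      unfolding nondegenerate_at_def
    proof (intro ballI impI)
      fix e assume e: "e \<in> A" "p \<in> fst e"
      obtain d where d: "d \<in> A" "p \<in> fst d" "gradient (g \<circ> chart_inv d) (snd d p) = 0"
        using crit critical_point_iff_gradient[OF g] unfolding critical_point_def by blast
      obtain P where P: "P \<in> \<V>" "p \<in> P" using p \<V>(3) by blast
      then have c: "ch P \<in> A" "p \<in> fst (ch P)" using ch by blast+
      have "gradient (g \<circ> chart_inv (ch P)) (snd (ch P) p) = 0"
        by (rule critical_nondegenerate_change_of_chart(1)[OF assms(1) g d(1,2) c d(3)])
      moreover from this have "det (hessian (g \<circ> chart_inv (ch P)) (snd (ch P) p)) \<noteq> 0"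
        using \<open>a \<notin> B\<close> P unfolding B_def degenerate_forms_def g_def by blast
      ultimately show "det (hessian (g \<circ> chart_inv e) (snd e p)) \<noteq> 0"
        using critical_nondegenerate_change_of_chart(2)[OF assms(1) g c e] by blast
    qed
    then show ?thesis
      unfolding g_eq Morse_function_def using g by blast
  qed
  ultimately show ?thesis by blast
qed

end
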